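(* Consider anonymous agents with CW whiteboards, in the synchronous or asynchronous model, with half-duplex or full-duplex links. In each of these models the quiescence number of the $k$-gossip problem is $-1$; that is, no self-stabilizing solution (not even a $0$-quiescent one) exists.
   Context: Network: a finite connected graph $G=(V,E)$. Nodes are anonymous (nodes of the same degree are identical). Each node labels its incident links with locally distinct labels; nothing else is assumed about the labels. Each node has a whiteboard (a public memory). Agents: $k$ mobile agents, each a deterministic state machine, are present at all times. In the anonymous agent model agents have no identifiers and are all identical. When an agent at a node executes its action, it may change its state, write on the node's whiteboard, and move to a neighboring node (or stay), based only on: its own state, the states of the agents currently at the same node, the local link labels of the node (and possibly the label of the incoming link), and the contents of the node's whiteboard. The algorithm is the same for all agents; it is given neither $k$ nor the network. Synchrony. Synchronous: lock-step rounds; in each round every agent executes its action and can move to a neighboring node; agents at the same node act in sequence within the round. (In this model whiteboards may also hold count-up timers that are increased by one automatically at every round.) Asynchronous: there is no bound on the number of moves an agent can make between two moves of another agent, but each agent is always eventually allowed to execute its action; agents at the same node act sequentially, agents at different nodes may act concurrently. Links. Full-duplex: two agents at neighboring nodes can swap positions simultaneously over the link joining them without meeting. Half-duplex: only one direction can be used at a time; if two agents at opposite ends try to cross simultaneously, only one succeeds. CW whiteboards: only control information can be stored on whiteboards, not gossip information. $k$-gossip problem: each of the $k$ agents is given an initial piece of information (gossip information), treated as opaque (it does not influence the agents' control behavior). With CW whiteboards, gossip information is transferred from agent to agent only by meeting at a node; agents may relay all gossip information collected. The goal is that every agent obtains the gossip information of all agents. Self-stabilizing solution: one algorithm, not depending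 on $k$ or on the network, such that for every network, every number of agents, and every initial configuration (arbitrary agent locations and states, arbitrary whiteboard contents), in every execution every agent eventually knows the gossip information of all agents in the system. $l$-quiescent (for an integer $l$, when $k$ agents are present): every execution with $k$ agents reaches a configuration after which $l$ or more agents remain still (never move) forever. The quiescence number of the $k$-gossip problem in a model is the maximum integer $l$ such that an $l$-quiescent self-stabilizing solution exists, and it is $-1$ if no $0$-quiescent self-stabilizing solution exists. *)

theory Defs
  imports "Graph_Theory.Digraph_Component" "HOL-Library.Multiset"
begin

section \<open>Networks\<close>

text \<open>
  Node names occur only in the description of configurations; agents never observe them, so
  taking natural numbers as names is no restriction.  An undirected link joining \<open>u\<close> and \<open>v\<close>
  is the pair of arcs \<open>(u, v)\<close> and \<open>(v, u)\<close>, and \<open>port N u v\<close> is the label that \<open>u\<close> gives to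
  this link (unrelated to the label \<open>port N v u\<close> at the other end).
\<close>

record network =
  topology :: "nat pair_pre_digraph"
  port :: "nat \<Rightarrow> nat \<Rightarrow> nat"

abbreviation nodes :: "network \<Rightarrow> nat set" where
  "nodes N \<equiv> pverts (topology N)"

definition neighbors :: "network \<Rightarrow> nat \<Rightarrow> nat set" where
  "neighbors N v = {u. (v, u) \<in> parcs (topology N)}"

definition ports :: "network \<Rightarrow> nat \<Rightarrow> nat set" where
  "ports N v = port N v ` neighbors N v"

definition valid_network :: "network \<Rightarrow> bool" where
  "valid_network N \<longleftrightarrow>
     pair_graph (topology N) \<and>
     Digraph_Component.connected (with_proj (topology N)) \<and>
     (\<forall>v \<in> nodes N. inj_on (port N v) (neighbors N v))"

definition port_target :: "network \<Rightarrow> nat \<Rightarrow> nat \<Rightarrow> nat option" where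
  "port_target N v p =
     (if p \<in> ports N v then Some (THE u. u \<in> neighbors N v \<and> port N v u = p) else None)"


section \<open>Anonymous agents and whiteboards\<close>

text \<open>
  Whiteboards and agent states carry control information only; gossip information is
  treated separately below.  The entries of \<open>timers\<close> can be read and overwritten like any
  other part of the whiteboard; in the synchronous model they are, in addition, incremented
  at the end of every round.
\<close>

record 'w whiteboard =
  content :: 'w
  timers :: "nat list"

text \<open>
  \<open>peer_states\<close> is a multiset, since agents are anonymous.  \<open>entry_label\<close> is the local label of the link
  through which the agent has just arrived, and \<open>None\<close> if its last action was not a
  (successful) move.
\<close>

record ('s, 'w) observation =
  own_state :: 's
  peer_states :: "'s multiset"
  local_labels :: "nat set"
  entry_label :: "nat option"
  whiteboard_seen :: "'w whiteboard"

record ('s, 'w) action =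
  next_state :: 's
  next_board :: "'w whiteboard"
  move :: "nat option"

type_synonym ('s, 'w) algorithm = "('s, 'w) observation \<Rightarrow> ('s, 'w) action"


section \<open>Configurations and steps\<close>

text \<open>
  The \<open>k\<close> agents are named \<open>0, \<dots>, k - 1\<close> from the outside; algorithms never see these names.
\<close>

record ('s, 'w) config =
  loc :: "nat \<Rightarrow> nat"
  state :: "nat \<Rightarrow> 's"
  entry :: "nat \<Rightarrow> nat option"
  board :: "nat \<Rightarrow> 'w whiteboard"

definition valid_config :: "network \<Rightarrow> nat \<Rightarrow> ('s, 'w) config \<Rightarrow> bool" where
  "valid_config N k c \<longleftrightarrow>
     (\<forall>a<k. loc c a \<in> nodes N \<and> set_option (entry c a) \<subseteq> ports N (loc c a))"

datatype timing = Synchronous | Asynchronous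
datatype duplex = Half_Duplex | Full_Duplex

text \<open>
  Within one step the activated agents are processed one after the other.  The second
  component \<open>dep\<close> of the intermediate state records the destinations of the agents that have
  already left their node in this step; their locations are updated only at the end of the
  step, so agents in transit or just arriving are not visible to others.
\<close>

definition observe ::
  "network \<Rightarrow> nat \<Rightarrow> ('s, 'w) config \<Rightarrow> (nat \<Rightarrow> nat option) \<Rightarrow> nat \<Rightarrow> ('s, 'w) observation" where
  "observe N k c dep a =
     \<lparr> own_state = state c a,
       peer_states = image_mset (state c)
         (mset_set {b. b < k \<and> b \<noteq> a \<and> loc c b = loc c a \<and> dep b = None}),
       local_labels = ports N (loc c a),
       entry_label = entry c a,
       whiteboard_seen = board c (loc c a) \<rparr>"

text \<open>
  On a half-duplex link the direction of traffic in a step is determined by the first agent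
  that uses the link; an agent that attempts to cross in the opposite direction in the same
  step stays at its node.
\<close>

definition destination ::
  "duplex \<Rightarrow> network \<Rightarrow> nat \<Rightarrow> ('s, 'w) config \<Rightarrow> (nat \<Rightarrow> nat option) \<Rightarrow> nat \<Rightarrow> nat option \<Rightarrow> nat option"
where
  "destination dx N k c dep a mv =
     (case Option.bind mv (port_target N (loc c a)) of
        None \<Rightarrow> None
      | Some u \<Rightarrow>
          if dx = Half_Duplex \<and> (\<exists>b<k. loc c b = u \<and> dep b = Some (loc c a)) then None
          else Some u)"

definition act ::
  "duplex \<Rightarrow> network \<Rightarrow> ('s, 'w) algorithm \<Rightarrow> nat \<Rightarrow> nat \<Rightarrow>
     ('s, 'w) config \<times> (nat \<Rightarrow> nat option) \<Rightarrow> ('s, 'w) config \<times> (nat \<Rightarrow> nat option)" where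
  "act dx N A k a = (\<lambda>(c, dep).
     let r = A (observe N k c dep a) in
       (c\<lparr> state := (state c)(a := next_state r),
           entry := (entry c)(a := None),
           board := (board c)(loc c a := next_board r) \<rparr>,
        dep(a := destination dx N k c dep a (move r))))"

definition arrive :: "network \<Rightarrow> ('s, 'w) config \<times> (nat \<Rightarrow> nat option) \<Rightarrow> ('s, 'w) config" where
  "arrive N = (\<lambda>(c, dep).
     c\<lparr> loc := (\<lambda>a. case dep a of None \<Rightarrow> loc c a | Some u \<Rightarrow> u),
        entry := (\<lambda>a. case dep a of None \<Rightarrow> entry c a | Some u \<Rightarrow> Some (port N u (loc c a))) \<rparr>)"

definition tick :: "timing \<Rightarrow> ('s, 'w) config \<Rightarrow> ('s, 'w) config" where
  "tick tm c =
     (case tm of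
        Synchronous \<Rightarrow> c\<lparr> board := (\<lambda>v. (board c v)\<lparr> timers := map Suc (timers (board c v)) \<rparr>) \<rparr>
      | Asynchronous \<Rightarrow> c)"

definition step ::
  "timing \<Rightarrow> duplex \<Rightarrow> network \<Rightarrow> ('s, 'w) algorithm \<Rightarrow> nat \<Rightarrow> nat list \<Rightarrow>
     ('s, 'w) config \<Rightarrow> ('s, 'w) config" where
  "step tm dx N A k sched c =
     tick tm (arrive N (fold (act dx N A k) sched (c, \<lambda>_. None)))"

text \<open>
  A schedule lists the agents activated in a step: all of them in the synchronous model, and
  any agents at pairwise different nodes (acting concurrently) in the asynchronous model.
  The order, chosen by the adversary, matters only among agents at the same node and for
  contention on half-duplex links.
\<close>

definition admissible :: "timing \<Rightarrow> nat \<Rightarrow> ('s, 'w) config \<Rightarrow> nat list \<Rightarrow> bool" where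
  "admissible tm k c sched \<longleftrightarrow>
     distinct sched \<and>
     (case tm of
        Synchronous \<Rightarrow> set sched = {..<k}
      | Asynchronous \<Rightarrow> set sched \<subseteq> {..<k} \<and> inj_on (loc c) (set sched))"

definition execution ::
  "timing \<Rightarrow> duplex \<Rightarrow> network \<Rightarrow> ('s, 'w) algorithm \<Rightarrow> nat \<Rightarrow> (nat \<Rightarrow> ('s, 'w) config) \<Rightarrow> bool" where
  "execution tm dx N A k e \<longleftrightarrow>
     valid_config N k (e 0) \<and>
     (\<exists>sched.
        (\<forall>t. admissible tm k (e t) (sched t) \<and> e (Suc t) = step tm dx N A k (sched t) (e t)) \<and>
        (\<forall>a<k. \<forall>t. \<exists>t'\<ge>t. a \<in> set (sched t')))"


section \<open>Gossip with CW whiteboards\<close>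

text \<open>
  \<open>known k e t a\<close> is the set of agents whose initial gossip information is known to agent \<open>a\<close>
  at time \<open>t\<close> of the execution \<open>e\<close>: agents at the same node exchange everything they know,
  and this is the only way information spreads.
\<close>

definition meeting :: "nat \<Rightarrow> ('s, 'w) config \<Rightarrow> nat \<Rightarrow> nat set" where
  "meeting k c a = {b. b < k \<and> loc c b = loc c a}"

primrec known :: "nat \<Rightarrow> (nat \<Rightarrow> ('s, 'w) config) \<Rightarrow> nat \<Rightarrow> nat \<Rightarrow> nat set" where
  "known k e 0 a = (\<Union>b \<in> meeting k (e 0) a. {b})"
| "known k e (Suc t) a = (\<Union>b \<in> meeting k (e (Suc t)) a. known k e t b)"

definition self_stabilizing_gossip :: "timing \<Rightarrow> duplex \<Rightarrow> ('s, 'w) algorithm \<Rightarrow> bool" where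
  "self_stabilizing_gossip tm dx A \<longleftrightarrow>
     (\<forall>N k e. valid_network N \<and> k \<ge> 1 \<and> execution tm dx N A k e \<longrightarrow>
        (\<forall>a<k. \<exists>t. known k e t a = {..<k}))"

definition quiescent :: "timing \<Rightarrow> duplex \<Rightarrow> nat \<Rightarrow> int \<Rightarrow> ('s, 'w) algorithm \<Rightarrow> bool" where
  "quiescent tm dx k l A \<longleftrightarrow>
     (\<forall>N e. valid_network N \<and> execution tm dx N A k e \<longrightarrow>
        (\<exists>T S. S \<subseteq> {..<k} \<and> int (card S) \<ge> l \<and> (\<forall>a\<in>S. \<forall>t\<ge>T. loc (e t) a = loc (e T) a)))"

text \<open>
  The first two arguments fix the types of agent states and of whiteboard contents available
  to algorithms.
\<close>

definition quiescence_number ::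
  "'s itself \<Rightarrow> 'w itself \<Rightarrow> timing \<Rightarrow> duplex \<Rightarrow> nat \<Rightarrow> int" where
  "quiescence_number _ _ tm dx k =
     (if \<exists>A :: ('s, 'w) algorithm. self_stabilizing_gossip tm dx A \<and> quiescent tm dx k 0 A
      then GREATEST l. \<exists>A :: ('s, 'w) algorithm. self_stabilizing_gossip tm dx A \<and> quiescent tm dx k l A
      else - 1)"

end

theory Submission
  imports Defs
begin

text \<open>
  Two agents in the same state are placed at opposite nodes of a 4-cycle whose link labels are
  invariant under the half-turn, with equal whiteboards at opposite nodes.  The adversary always
  activates both agents in the same step; this is admissible in the synchronous as well as in the
  asynchronous model, since the agents are at different nodes.  Both then observe and do the same,
  so the configuration stays invariant under the half-turn and the agents never meet.  Opposite
  nodes of a 4-cycle are not adjacent, so the agents never try to use the same link and the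
  argument does not depend on the duplex mode of the links.
\<close>

definition four_cycle :: network where
  "four_cycle =
     \<lparr> topology = \<lparr> pverts = {..<4}, parcs = {(u, v). u < 4 \<and> v < 4 \<and> odd (u + v)} \<rparr>,
       port = (\<lambda>u v. (v + 3 * u) mod 4) \<rparr>"
  \<comment> \<open>the label \<open>(v + 3 * u) mod 4\<close> is \<open>v - u\<close> modulo 4\<close>

definition opposite :: "nat \<Rightarrow> nat" where
  "opposite v = (v + 2) mod 4"

lemma less_4_iff: "v < 4 \<longleftrightarrow> v = 0 \<or> v = 1 \<or> v = 2 \<or> v = 3"
  for v :: nat
  by linarith

lemma nodes_four_cycle [simp]: "nodes four_cycle = {..<4}"
  by (simp add: four_cycle_def)

lemma port_four_cycle [simp]: "port four_cycle u v = (v + 3 * u) mod 4"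
  by (simp add: four_cycle_def)

text \<open>For numbers below 4, opposite parity means a difference of 1 or 3 modulo 4, so the
  parity condition on arcs indeed yields a cycle.\<close>

lemma neighbors_four_cycle:
  assumes "v < 4"
  shows "neighbors four_cycle v = {(v + 1) mod 4, (v + 3) mod 4}"
  using assms
  by (auto simp: less_4_iff neighbors_def four_cycle_def)

lemma ports_four_cycle:
  assumes "v < 4"
  shows "ports four_cycle v = {1, 3}"
  using assms
  by (auto simp: less_4_iff ports_def neighbors_four_cycle)

lemma inj_on_port_four_cycle:
  assumes "v < 4"
  shows "inj_on (port four_cycle v) (neighbors four_cycle v)"
  using assms by (auto simp: less_4_iff neighbors_four_cycle)

lemma port_target_four_cycle:
  assumes "v < 4"
  shows "port_target four_cycle v p = (if p \<in> {1, 3} then Some ((v + p) mod 4) else None)"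
proof (cases "p \<in> {1, 3}")
  case True
  have "(THE u. u \<in> neighbors four_cycle v \<and> port four_cycle v u = p) = (v + p) mod 4"
  proof (rule the_equality)
    show *: "(v + p) mod 4 \<in> neighbors four_cycle v \<and> port four_cycle v ((v + p) mod 4) = p"
      using assms True by (auto simp: less_4_iff neighbors_four_cycle)
    show "u = (v + p) mod 4" if "u \<in> neighbors four_cycle v \<and> port four_cycle v u = p" for u
      using that * inj_on_port_four_cycle[OF assms] by (metis inj_onD)
  qed
  with True show ?thesis
    by (simp add: port_target_def ports_four_cycle assms)
qed (simp add: port_target_def ports_four_cycle assms)

lemma connected_four_cycle: "Digraph_Component.connected (with_proj (topology four_cycle))"
  (is "Digraph_Component.connected ?G")
proof -
  let ?S = "mk_symmetric ?G"
  have wf: "wf_digraph ?G"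
    by unfold_locales (auto simp: four_cycle_def)
  interpret S: pair_wf_digraph ?S
    using wf by (rule wf_digraph.wellformed_mk_symmetric)
  have arc: "u \<rightarrow>\<^sup>*\<^bsub>?S\<^esub> v" if "u < 4" "v < 4" "odd (u + v)" for u v
    using that by (intro S.reachable_adjI) (auto simp: parcs_mk_symmetric four_cycle_def)
  have "u \<rightarrow>\<^sup>*\<^bsub>?S\<^esub> v" if uv: "u < 4" "v < 4" for u v
  proof (cases "odd (u + v)")
    case True
    with uv show ?thesis by (rule arc)
  next
    case False
    \<comment> \<open>Here \<open>u\<close> and \<open>v\<close> have equal parity, so the successor
      of \<open>u\<close> is adjacent to both; this covers \<open>u = v\<close> too.\<close>
    let ?w = "(u + 1) mod 4"
    have "odd (u + ?w)" "odd (?w + v)"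
      using False by presburger+
    then have "u \<rightarrow>\<^sup>*\<^bsub>?S\<^esub> ?w" "?w \<rightarrow>\<^sup>*\<^bsub>?S\<^esub> v"
      using uv by (auto intro!: arc)
    then show ?thesis by (rule S.reachable_trans)
  qed
  then show ?thesis
    unfolding connected_def by (intro strongly_connectedI) (simp_all add: lessThan_empty_iff)
qed

lemma valid_network_four_cycle: "valid_network four_cycle"
proof -
  have "finite (parcs (topology four_cycle))"
    by (rule finite_subset[of _ "{..<4} \<times> {..<4}"]) (auto simp: four_cycle_def)
  then have "pair_graph (topology four_cycle)"
    by unfold_locales
      (auto simp: four_cycle_def symmetric_def sym_def)
  then show ?thesis
    by (simp add: valid_network_def connected_four_cycle inj_on_port_four_cycle)
qed

text \<open>Whiteboards are compared at all nodes, not only at the occupied ones, since the agents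
  may read any of them later.\<close>

definition antipodal :: "('s, 'w) config \<Rightarrow> bool" where
  "antipodal c \<longleftrightarrow>
     loc c 0 < 4 \<and> loc c 1 = opposite (loc c 0) \<and>
     state c 0 = state c 1 \<and> entry c 0 = entry c 1 \<and>
     (\<forall>v<4. board c (opposite v) = board c v)"

lemma opposite_less [simp]: "opposite v < 4"
  by (simp add: opposite_def)

lemma opposite_opposite:
  assumes "v < 4"
  shows "opposite (opposite v) = v"
  using assms by (auto simp: less_4_iff opposite_def)

lemma opposite_neq: "opposite v \<noteq> v"
  unfolding opposite_def by presburger

text \<open>Labels are differences modulo 4, so the half-turn preserves them.\<close>

lemma port_target_opposite:
  assumes "v < 4"
  shows "port_target four_cycle (opposite v) p = map_option opposite (port_target four_cycle v p)"
  using assms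
  by (auto simp: less_4_iff port_target_four_cycle opposite_def)

text \<open>Ensures that two agents making opposite moves get the same \<open>entry\<close> label on
  arrival.\<close>

lemma port_opposite:
  "port four_cycle (opposite u) (opposite v) = port four_cycle u v"
proof -
  have "((v + 2) mod 4 + 3 * ((u + 2) mod 4)) mod 4 = ((v + 2) + 3 * (u + 2)) mod 4"
    by (rule mod_add_cong[OF mod_mod_trivial mod_mult_cong[OF refl mod_mod_trivial]])
  also have "\<dots> = (v + 3 * u + 2 * 4) mod 4"
    by (simp add: algebra_simps)
  finally show ?thesis
    by (simp only: port_four_cycle opposite_def mod_mult_self1)
qed

text \<open>Ports lead 1 or 3 steps around the cycle, never 0 or 2. This rules out half-duplex
  conflicts between opposite agents.\<close>

lemma port_target_neq_opposite:
  assumes "v < 4"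
  shows "port_target four_cycle v p \<noteq> Some v" "port_target four_cycle v p \<noteq> Some (opposite v)"
  using assms
  by (auto simp: less_4_iff port_target_four_cycle opposite_def split: if_splits)

lemma port_target_less:
  "v < 4 \<Longrightarrow> port_target four_cycle v p = Some u \<Longrightarrow> u < 4"
  by (auto simp: port_target_four_cycle split: if_splits)

lemma antipodal_step:
  assumes "antipodal c"
  shows "antipodal (step tm dx four_cycle A 2 [0, 1] c)"
proof -
  define x where "x = loc c 0"
  let ?y = "opposite x"
  have x: "x < 4" and loc: "loc c 0 = x" "loc c 1 = ?y"
    and st: "state c 1 = state c 0" and en: "entry c 1 = entry c 0"
    and bd: "\<And>v. v < 4 \<Longrightarrow> board c (opposite v) = board c v"
    using assms by (simp_all add: antipodal_def x_def)
  have y: "?y \<noteq> x" "x \<noteq> ?y" "opposite ?y = x"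
    using opposite_neq[of x] opposite_opposite[OF x] by auto
  \<comment> \<open>\<open>r\<close> is the action chosen by agent 0 and \<open>d\<close> its
    destination; \<open>c1\<close> and \<open>c2\<close> are the configurations after agent 0 and
    then agent 1 have acted. \<open>c2\<close> anticipates that agent 1 also chooses
    \<open>r\<close>.\<close>
  define r where "r = A (observe four_cycle 2 c (\<lambda>_. None) 0)"
  define d where "d = Option.bind (move r) (port_target four_cycle x)"
  define c1 where "c1 = c\<lparr>state := (state c)(0 := next_state r), entry := (entry c)(0 := None),
     board := (board c)(x := next_board r)\<rparr>"
  define c2 where "c2 = c1\<lparr>state := (state c1)(1 := next_state r), entry := (entry c1)(1 := None),
     board := (board c1)(?y := next_board r)\<rparr>"
  have d: "d \<noteq> Some x" "d \<noteq> Some ?y" "\<And>u. d = Some u \<Longrightarrow> u < 4"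
    using port_target_neq_opposite[OF x] port_target_less[OF x]
    by (cases "move r"; auto simp: d_def)+
  have d': "Option.bind (move r) (port_target four_cycle ?y) = map_option opposite d"
    by (cases "move r") (auto simp: d_def port_target_opposite[OF x])
  have less_2: "b < 2 \<longleftrightarrow> b = 0 \<or> b = 1" for b :: nat
    by auto
  have d0: "destination dx four_cycle 2 c (\<lambda>_. None) 0 (move r) = d"
    by (cases d) (simp_all add: destination_def loc flip: d_def)
  have act0: "act dx four_cycle A 2 0 (c, \<lambda>_. None) = (c1, (\<lambda>_. None)(0 := d))"
    using d0 by (simp add: act_def Let_def c1_def loc flip: r_def)
  have loc1: "loc c1 = loc c"
    by (simp add: c1_def)
  have no_peers: "{b. b < 2 \<and> b \<noteq> 0 \<and> loc c b = loc c 0 \<and> dep b = None} = {}"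
    "{b. b < 2 \<and> b \<noteq> 1 \<and> loc c1 b = loc c1 1 \<and> dep b = None} = {}"
    for dep :: "nat \<Rightarrow> nat option"
    using y loc by (auto simp: less_2 loc1)
  \<comment> \<open>Agent 0 has written only at \<open>x\<close>, so agent 1 at \<open>?y\<close>
    still finds the whiteboard content that agent 0 found.\<close>
  have "state c1 1 = state c 0" "entry c1 1 = entry c 0" "board c1 ?y = board c x"
    using st en bd[OF x] y by (simp_all add: c1_def)
  then have "observe four_cycle 2 c1 ((\<lambda>_. None)(0 := d)) 1 = observe four_cycle 2 c (\<lambda>_. None) 0"
    unfolding observe_def no_peers by (simp only: loc1 loc ports_four_cycle x opposite_less image_mset_empty mset_set.empty)
  then have r1: "A (observe four_cycle 2 c1 ((\<lambda>_. None)(0 := d)) 1) = r"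
    by (simp add: r_def)
  \<comment> \<open>Agent 1 could be blocked only by an agent already leaving for \<open>?y\<close>:
    agent 0 does not head there, and agent 1 has no departure recorded yet.\<close>
  have "\<not> (\<exists>b<2. loc c b = opposite u \<and> ((\<lambda>_. None)(0 := d)) b = Some ?y)" for u
    using d by (auto simp: less_2)
  then have d1: "destination dx four_cycle 2 c1 ((\<lambda>_. None)(0 := d)) 1 (move r) = map_option opposite d"
    using d' loc by (cases d) (auto simp: destination_def loc1)
  have act1: "act dx four_cycle A 2 1 (c1, (\<lambda>_. None)(0 := d)) =
      (c2, (\<lambda>_. None)(0 := d, 1 := map_option opposite d))"
    using r1 d1 loc by (simp add: act_def Let_def c2_def loc1)
  have step: "step tm dx four_cycle A 2 [0, 1] c =
      tick tm (arrive four_cycle (c2, (\<lambda>_. None)(0 := d, 1 := map_option opposite d)))"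
    using act0 act1 by (simp add: step_def)
  have bd2: "board c2 (opposite v) = board c2 v" if "v < 4" for v
    using y bd[OF that] opposite_opposite[OF that] by (auto simp: c2_def c1_def)
  have loc2: "loc c2 0 = x" "loc c2 1 = ?y"
    using loc by (simp_all add: c2_def c1_def)
  have rest2: "state c2 0 = state c2 1" "entry c2 0 = entry c2 1"
    by (simp_all add: c2_def c1_def)
  have "antipodal (arrive four_cycle (c2, (\<lambda>_. None)(0 := d, 1 := map_option opposite d)))"
    using x loc2 rest2 bd2 d(3)
    by (cases d) (simp_all add: antipodal_def arrive_def port_opposite del: port_four_cycle)
  \<comment> \<open>In the synchronous case all timers advance alike, so opposite whiteboards stay
    equal.\<close>
  then show ?thesis
    unfolding step by (cases tm) (auto simp: antipodal_def tick_def)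
qed

lemma meeting_antipodal:
  assumes "antipodal c" and "a < 2"
  shows "meeting 2 c a = {a}"
proof -
  have "loc c 0 \<noteq> loc c 1"
    using assms opposite_neq[of "loc c 0"] by (simp add: antipodal_def)
  then show ?thesis
    using assms(2) by (auto simp: meeting_def less_2_cases_iff)
qed

text \<open>Each agent is always alone at its node, so no meeting ever adds to its initial
  information.\<close>

lemma known_antipodal:
  assumes "\<And>t. antipodal (e t)" and "a < 2"
  shows "known 2 e t a = {a}"
  using assms by (induction t) (simp_all add: meeting_antipodal)

lemma antipodal_execution_exists:
  fixes A :: "('s, 'w) algorithm"
  obtains e where "execution tm dx four_cycle A 2 e" and "\<And>t. antipodal (e t)"
proof
  \<comment> \<open>Agents 0 and 1 start at nodes 0 and 2. State and whiteboard content are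
    arbitrary values; the symmetry only needs them to be the same everywhere.\<close>
  define c :: "('s, 'w) config" where
    "c = \<lparr> loc = (\<lambda>a. 2 * a), state = (\<lambda>_. undefined), entry = (\<lambda>_. None),
           board = (\<lambda>_. \<lparr> content = undefined, timers = [] \<rparr>) \<rparr>"
  define e where "e t = (step tm dx four_cycle A 2 [0, 1] ^^ t) c" for t
  have "antipodal c"
    by (simp add: c_def antipodal_def opposite_def)
  then show *: "antipodal (e t)" for t
    by (induction t) (simp_all add: e_def antipodal_step[unfolded One_nat_def])
  \<comment> \<open>The synchronous model asks that both agents be listed, the asynchronous one that
    they be at different nodes, which \<open>antipodal\<close> provides.\<close>
  have "admissible tm 2 (e t) [0, 1]" for t
  proof -
    have "loc (e t) 0 \<noteq> loc (e t) 1"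
      using *[of t] opposite_neq[of "loc (e t) 0"] by (simp add: antipodal_def)
    then show ?thesis
      by (cases tm) (auto simp: admissible_def)
  qed
  moreover have "valid_config four_cycle 2 (e 0)"
    by (auto simp: valid_config_def e_def c_def)
  moreover have "e (Suc t) = step tm dx four_cycle A 2 [0, 1] (e t)" for t
    by (simp add: e_def)
  ultimately show "execution tm dx four_cycle A 2 e"
    unfolding execution_def by (intro conjI exI[of _ "\<lambda>_. [0, 1]"]) auto
qed

lemma not_self_stabilizing_gossip: "\<not> self_stabilizing_gossip tm dx A"
proof
  assume "self_stabilizing_gossip tm dx A"
  moreover obtain e where "execution tm dx four_cycle A 2 e" and e: "\<And>t. antipodal (e t)"
    using antipodal_execution_exists by blast
  ultimately have "\<forall>a<2. \<exists>t. known 2 e t a = {..<2}"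
    unfolding self_stabilizing_gossip_def using valid_network_four_cycle one_le_numeral by blast
  then obtain t where "known 2 e t 0 = {..<2}"
    using zero_less_numeral by blast
  then show False
    using known_antipodal[of e 0 t] e by auto
qed

text \<open>A self-stabilizing solution must handle every number of agents, so the two-agent
  counterexample excludes one whatever \<open>k\<close> is, and \<open>quiescence_number\<close>
  takes its default \<open>- 1\<close>.\<close>

theorem theorem8:
  fixes tm :: timing and dx :: duplex and k :: nat
  assumes "k \<ge> 1"
  shows "quiescence_number TYPE('s) TYPE('w) tm dx k = - 1
       \<and> \<not> (\<exists>A :: ('s, 'w) algorithm. self_stabilizing_gossip tm dx A)"
  by (simp add: quiescence_number_def not_self_stabilizing_gossip)

end
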